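(* There is a constant $C$ such that the following estimate holds for $x>2$ (and $\rho>0$): $$H(x,\rho)=\frac{\Gamma\left(\frac13\right)}{3\pi\rho^2}\cos\left(\pi\left(x-\tfrac16\right)\right)\left[\frac6x\right]^{1/3}+R,\qquad |R|\le\frac{C}{x\rho^4}.$$ In particular, when $(x,\rho)$ are such that $x\rho^3$ tends to $\infty$, one has $$H(x,\rho)\sim\frac{\Gamma\left(\frac13\right)}{3\pi\rho^2}\cos\left(\pi\left(x-\tfrac16\right)\right)\left[\frac6x\right]^{1/3}$$ under the condition that, moreover, $x$ stays uniformly far away from the points at which the cosine vanishes, that is, $x-\frac23\notin\mathbb Z+(-\varepsilon,+\varepsilon)$ for some positive $\varepsilon$.
   Context: The restricted Good function is defined for $x\in\mathbb R$ and $\rho>0$ by $$H(x,\rho):=\frac1\pi\int_0^\pi\frac{\cos\big(x(\theta+\sin\theta)\big)}{\rho^2+\sin^2\theta}\,d\theta .$$ $\Gamma$ is Euler's Gamma function. The constant $C$ does not depend on $x$ and $\rho$. The notation $H\sim M$ means $H=M+R$ with $R=o(|M|)$ in the indicated regime.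
   Formalization: The bound C/(xρ⁴) fails for fixed x as ρ→∞ (e.g. x=3); it is proved for ρ≤1 (hence bounded ρ, with C depending on the bound), with C/(xρ²) for ρ≥1. The asymptotic claim additionally assumes x→∞, automatic when ρ is bounded. *)

theory Defs
  imports "HOL-Analysis.Analysis" "HOL-Library.Landau_Symbols" "HOL-Library.Set_Algebras"
begin

definition good_H :: "real \<Rightarrow> real \<Rightarrow> real" where
  "good_H x \<rho> =
     1 / pi * integral {0..pi} (\<lambda>\<theta>. cos (x * (\<theta> + sin \<theta>)) / (\<rho>\<^sup>2 + (sin \<theta>)\<^sup>2))"

definition good_main :: "real \<Rightarrow> real \<Rightarrow> real" where
  "good_main x \<rho> =
     Gamma (1/3) / (3 * pi * \<rho>\<^sup>2) * cos (pi * (x - 1/6)) * (6 / x) powr (1/3)"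

text \<open>
  The error of \<open>good_main\<close> is uniformly \<open>O(1 / (x * \<rho> ^ 4))\<close> only for bounded \<open>\<rho>\<close>.  For fixed \<open>x\<close>
  and \<open>\<rho> \<rightarrow> \<infinity>\<close>, \<open>\<rho>\<^sup>2 * (good_H x \<rho> - good_main x \<rho>)\<close> tends to the error of the leading
  asymptotic term of the Anger-type integral \<open>1 / pi * integral {0..pi} (\<lambda>\<theta>. cos (x * (\<theta> + sin \<theta>)))\<close>,
  which is nonzero for generic \<open>x\<close>; the correct order for large \<open>\<rho>\<close> is \<open>1 / (x * \<rho>\<^sup>2)\<close>.
\<close>

text \<open>
  A regime is a filter; \<open>H \<sim> M\<close> means \<open>H = M + R\<close> with \<open>R = o(|M|)\<close>.
\<close>
definition sim_regime :: "'a filter \<Rightarrow> ('a \<Rightarrow> real) \<Rightarrow> ('a \<Rightarrow> real) \<Rightarrow> bool" where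
  "sim_regime F H M \<longleftrightarrow> (\<lambda>p. H p - M p) \<in> o[F](\<lambda>p. \<bar>M p\<bar>)"

end

theory Submission
  imports Defs "HOL-Complex_Analysis.Cauchy_Integral_Theorem" "HOL-Real_Asymp.Real_Asymp"
begin

text \<open>
  With \<open>\<theta> = \<pi> - t\<close> the phase becomes \<open>\<pi> - (t - sin t)\<close>, which has a double critical point at \<open>t = 0\<close>.
  In the variable \<open>w = (6 (t - sin t))\<^bsup>1/3\<^esup>\<close> the phase is exactly cubic, so the integral of
  \<open>exp (- i x (t - sin t)) w'(t)\<close> is a value of the primitive \<open>F\<close> of \<open>exp (- z\<^sup>3)\<close> far out on the ray
  \<open>arg z = \<pi>/6\<close>, where \<open>F\<close> is close to \<open>\<Gamma>(4/3)\<close>.  What remains is the amplitude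
  \<open>1 / (\<rho>\<^sup>2 + sin\<^sup>2 t) - w'(t) / \<rho>\<^sup>2\<close>.  It is the derivative \<open>1 - cos t\<close> of the phase times
  \<open>D(t) = (1 / (1 - cos t) - 2 / w\<^sup>2 - (1 + cos t) / (\<rho>\<^sup>2 + sin\<^sup>2 t)) / \<rho>\<^sup>2\<close>,
  since \<open>sin\<^sup>2 t = (1 - cos t) (1 + cos t)\<close>.  As \<open>D\<close> is bounded and of bounded variation, of order
  \<open>1 / \<rho>\<^sup>2 + 1 / \<rho>\<^sup>4\<close>, one integration by parts gains the factor \<open>1 / x\<close>.
\<close>

section \<open>Elementary bounds for sine and cosine\<close>

lemma sin_taylor_bound:
  fixes t :: real
  shows "\<bar>sin t - (t - t ^ 3 / 6 + t ^ 5 / 120)\<bar> \<le> \<bar>t\<bar> ^ 7 / 5040"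
  using Maclaurin_sin_bound[of t 7]
  by (simp add: sin_coeff_def lessThan_nat_numeral fact_numeral field_simps)

lemma cos_taylor_bound:
  fixes t :: real
  shows "\<bar>cos t - (1 - t ^ 2 / 2 + t ^ 4 / 24)\<bar> \<le> \<bar>t\<bar> ^ 6 / 720"
proof -
  obtain s where "cos t = (\<Sum>m<6. cos_coeff m * t ^ m) + cos (s + 1/2 * real 6 * pi) / fact 6 * t ^ 6"
    using Maclaurin_cos_expansion[of t 6] by blast
  then have "cos t - (1 - t ^ 2 / 2 + t ^ 4 / 24) = cos (s + 1/2 * real 6 * pi) / fact 6 * t ^ 6"
    by (simp add: cos_coeff_def lessThan_nat_numeral fact_numeral field_simps)
  then have "\<bar>cos t - (1 - t ^ 2 / 2 + t ^ 4 / 24)\<bar> = \<bar>cos (s + 1/2 * real 6 * pi)\<bar> * (\<bar>t\<bar> ^ 6 / 720)"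
    by (simp only: abs_mult abs_divide) (simp add: fact_numeral power_abs)
  also have "\<dots> \<le> 1 * (\<bar>t\<bar> ^ 6 / 720)"
    by (intro mult_right_mono) auto
  finally show ?thesis by simp
qed

text \<open>A Jordan-type inequality with the convenient constant 1/2. As y^2 <= 2.56, the two
  highest Taylor terms together are nonnegative and 1 - y^2/6 is at least 1/2. It serves three
  times: for the decay on the arc, for a lower bound on 1 - cos t, and for the size of the cosine
  away from its zeros.\<close>

lemma half_le_sin:
  fixes y :: real
  assumes "0 \<le> y" "y \<le> pi / 2"
  shows "y / 2 \<le> sin y"
proof -
  have "y \<le> 8/5" using assms(2) pi_approx by simp
  then have y2: "y\<^sup>2 \<le> (8/5)\<^sup>2" using assms(1) by (intro power_mono) auto
  have "sin y \<ge> y - y ^ 3 / 6 + y ^ 5 / 120 - y ^ 7 / 5040"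
    using sin_taylor_bound[of y] assms(1) unfolding abs_le_iff by simp
  moreover have "y ^ 5 / 120 - y ^ 7 / 5040 = y ^ 5 * (1 / 120 - y\<^sup>2 / 5040)"
    by (simp add: field_simps flip: power_add)
  moreover have "y ^ 5 * (1 / 120 - y\<^sup>2 / 5040) \<ge> 0"
    using y2 assms(1) by (intro mult_nonneg_nonneg) (auto simp: power2_eq_square)
  moreover have "y - y ^ 3 / 6 = y * (1 - y\<^sup>2 / 6)"
    by (simp add: field_simps power2_eq_square power3_eq_cube)
  moreover have "y * (1 - y\<^sup>2 / 6) \<ge> y * (1/2)"
    using y2 assms(1) by (intro mult_left_mono) (auto simp: power2_eq_square)
  ultimately show ?thesis by linarith
qed

section \<open>The primitive of exp(-z^3) far out on the ray arg z = pi/6\<close>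

text \<open>Euler's integrand is nonnegative, so its integrability on the half-line is absolute, and
  the set integrals over [0,T] converge to the full one.\<close>

lemma Gamma_truncated_limit:
  fixes a :: real
  assumes "a > 0"
  shows "((\<lambda>T. integral {0..T} (\<lambda>t. t powr (a - 1) / exp t)) \<longlongrightarrow> Gamma a) at_top"
proof -
  let ?f = "\<lambda>t::real. t powr (a - 1) / exp t"
  have int: "(?f has_integral Gamma a) {0..}"
    by (rule Gamma_integral_real[OF assms])
  then have abs: "?f absolutely_integrable_on {0..}"
    by (intro nonnegative_absolutely_integrable_1) (auto simp: integrable_on_def)
  then have "((\<lambda>T. LINT t:{0..T}|lebesgue. ?f t) \<longlongrightarrow> (LINT t:{0..}|lebesgue. ?f t)) at_top"
    by (intro tendsto_set_lebesgue_integral_at_top) auto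
  moreover have "(LINT t:{0..}|lebesgue. ?f t) = Gamma a"
    using set_lebesgue_integral_eq_integral(2)[OF abs] int by (simp add: integral_unique)
  moreover have "(LINT t:{0..T}|lebesgue. ?f t) = integral {0..T} ?f" for T
    by (intro set_lebesgue_integral_eq_integral(2) set_integrable_subset[OF abs]) auto
  ultimately show ?thesis by simp
qed

text \<open>On the ray itself z^3 is purely imaginary and exp(-z^3) has modulus 1, so no absolute
  estimate along the ray is possible. The value is instead reached through the positive axis, where
  F tends to Gamma(4/3) with error 1/(2 r^2), followed by the circular arc from L to L cis(pi/6),
  which costs at most 1/L^2 as in Jordan's lemma.\<close>

lemma exp_neg_cube_primitive:
  obtains F :: "complex \<Rightarrow> complex" and C :: real
  where "F 0 = 0" "\<And>z. (F has_field_derivative exp (- (z ^ 3))) (at z)"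
    "\<And>L. L > 0 \<Longrightarrow> norm (F (of_real L * cis (pi / 6)) - of_real (Gamma (4/3))) \<le> C / L\<^sup>2"
proof -
  obtain G where G: "\<And>z::complex. (G has_field_derivative exp (- (z ^ 3))) (at z)"
  proof (rule holomorphic_convex_primitive')
    show "(\<lambda>z::complex. exp (- (z ^ 3))) holomorphic_on UNIV"
      by (intro holomorphic_intros)
  qed auto
  define F where "F z = G z - G 0" for z
  have F0: "F 0 = 0" by (simp add: F_def)
  have F: "(F has_field_derivative exp (- (z ^ 3))) (at z)" for z
    unfolding F_def by (auto intro!: derivative_eq_intros G)
  have vec: "((\<lambda>s. F (p s)) has_vector_derivative p' * exp (- (p s ^ 3))) (at s)"
    if "(p has_vector_derivative p') (at s)" for p p' and s :: real
    using field_vector_diff_chain_at[OF that F] by (simp only: o_def)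
  have contF: "continuous_on A F" for A
    by (intro continuous_at_imp_continuous_on ballI DERIV_isCont[OF F])
  define J where "J T = integral {0..T} (\<lambda>t::real. t powr (1/3) / exp t)" for T
  have J_lim: "(J \<longlongrightarrow> Gamma (4/3)) at_top"
    using Gamma_truncated_limit[of "4/3"] by (simp add: J_def[abs_def])
  have f_cont: "continuous_on {0..T} (\<lambda>t::real. t powr (1/3) / exp t)" for T
    by (intro continuous_on_divide continuous_on_powr' continuous_on_exp continuous_on_id
        continuous_on_const) auto
  have J_deriv: "(J has_real_derivative T powr (1/3) / exp T) (at T)" if "T > 0" for T
  proof -
    have "(J has_real_derivative T powr (1/3) / exp T) (at T within {0..T+1})"
      unfolding J_def using that
      by (intro integral_has_real_derivative f_cont) auto
    then show ?thesis using that
      by (subst (asm) at_within_interior) auto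
  qed
  have J_cont: "continuous_on {0..T} J" for T
    unfolding J_def by (intro indefinite_integral_continuous_1 integrable_continuous_real f_cont)
  \<comment> \<open>The substitution t = s^3 turns \<open>J (r ^ 3)\<close> into the integral of 3
    s^3 exp(-s^3), and integration by parts leaves the integral of exp(-s^3) minus r exp(-r^3). The
    proof checks that the difference of both sides has derivative 0. The mean value bound asks for
    derivatives only in the open interval, which suits \<open>J_deriv\<close>, available only for T
    > 0.\<close>
  have FJ: "F (of_real r) = of_real (J (r ^ 3) + r * exp (- (r ^ 3)))" if "r > 0" for r
  proof -
    let ?h = "\<lambda>s::real. F (of_real s) - of_real (J (s ^ 3) + s * exp (- (s ^ 3)))"
    have "norm (?h r - ?h 0) \<le> (\<lambda>_. 0) r - (\<lambda>_. 0::real) 0"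
    proof (rule differentiable_bound_general[OF that])
      show "continuous_on {0..r} ?h"
        by (intro continuous_intros continuous_on_compose2[OF contF]
            continuous_on_compose2[OF J_cont[of "r^3"]]) (auto intro!: power_mono)
      show "(?h has_vector_derivative 0) (at s)" if "0 < s" "s < r" for s
      proof -
        have "((\<lambda>s. J (s ^ 3)) has_real_derivative (s ^ 3) powr (1/3) / exp (s ^ 3) * (3 * s\<^sup>2)) (at s)"
          by (rule DERIV_chain2[where f = J and g = "\<lambda>s. s ^ 3", OF J_deriv])
             (use that in \<open>auto intro!: derivative_eq_intros\<close>)
        moreover have "(s ^ 3) powr (1/3) = s"
          using that by (simp add: powr_powr flip: powr_numeral)
        ultimately have "((\<lambda>s. J (s ^ 3) + s * exp (- (s ^ 3))) has_real_derivative exp (- (s ^ 3))) (at s)"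
          by (auto intro!: derivative_eq_intros simp: exp_minus field_simps power2_eq_square)
        then have J': "((\<lambda>s. of_real (J (s ^ 3) + s * exp (- (s ^ 3)))) has_vector_derivative
            of_real (exp (- (s ^ 3)))) (at s)"
          by (intro has_vector_derivative_of_real)
             (simp add: has_real_derivative_iff_has_vector_derivative)
        have F': "((\<lambda>s. F (of_real s)) has_vector_derivative 1 * exp (- (of_real s ^ 3))) (at s)"
          by (rule vec) (auto intro!: derivative_eq_intros)
        show ?thesis
          using has_vector_derivative_diff[OF F' J'] by (simp flip: exp_of_real)
      qed
      show "((\<lambda>_. 0::real) has_vector_derivative 0) (at s)" for s
        by (rule has_vector_derivative_const)
    qed auto
    then show ?thesis by (simp add: F0 J_def)
  qed
  have tail: "norm (of_real (Gamma (4/3)) - F (of_real r)) \<le> 1 / (2 * r\<^sup>2)" if "r > 0" for r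
  proof (rule tendsto_upperbound)
    have "((\<lambda>R. J (R ^ 3) + R * exp (- (R ^ 3))) \<longlongrightarrow> Gamma (4/3) + 0) at_top"
    proof (intro tendsto_add)
      show "((\<lambda>R. J (R ^ 3)) \<longlongrightarrow> Gamma (4/3)) at_top"
        by (rule filterlim_compose[OF J_lim]) (auto intro: filterlim_pow_at_top filterlim_ident)
      show "((\<lambda>R::real. R * exp (- (R ^ 3))) \<longlongrightarrow> 0) at_top"
        by real_asymp
    qed
    then have "((\<lambda>R. complex_of_real (J (R ^ 3) + R * exp (- (R ^ 3)))) \<longlongrightarrow> of_real (Gamma (4/3))) at_top"
      by (intro tendsto_of_real) simp
    then have "((\<lambda>R. F (of_real R)) \<longlongrightarrow> of_real (Gamma (4/3))) at_top"
      by (rule Lim_transform_eventually) (use eventually_gt_at_top[of 0] in eventually_elim, simp add: FJ)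
    then show "((\<lambda>R. norm (F (of_real R) - F (of_real r))) \<longlongrightarrow> norm (of_real (Gamma (4/3)) - F (of_real r))) at_top"
      by (intro tendsto_intros)
    show "\<forall>\<^sub>F R in at_top. norm (F (of_real R) - F (of_real r)) \<le> 1 / (2 * r\<^sup>2)"
      using eventually_gt_at_top[of r]
    proof eventually_elim
      case (elim R)
      \<comment> \<open>The majorant is a primitive of 1/s^3, which dominates exp(-s^3) because u <=
        exp u.\<close>
      have "norm (F (of_real R) - F (of_real r)) \<le> - 1 / (2 * R\<^sup>2) - (- 1 / (2 * r\<^sup>2))"
      proof (rule differentiable_bound_general[OF elim])
        show "continuous_on {r..R} (\<lambda>s. F (of_real s))"
          by (intro continuous_on_compose2[OF contF]) (auto intro!: continuous_intros)
        show "continuous_on {r..R} (\<lambda>s. - 1 / (2 * s\<^sup>2))"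
          using \<open>r > 0\<close> by (auto intro!: continuous_intros)
        fix s assume s: "r < s" "s < R"
        show "((\<lambda>s. F (of_real s)) has_vector_derivative 1 * exp (- (of_real s ^ 3))) (at s)"
          by (rule vec) (auto intro!: derivative_eq_intros)
        show "((\<lambda>s. - 1 / (2 * s\<^sup>2)) has_vector_derivative 1 / s ^ 3) (at s)"
          unfolding has_real_derivative_iff_has_vector_derivative[symmetric]
          using s \<open>r > 0\<close> by (auto intro!: derivative_eq_intros simp: field_simps power2_eq_square power3_eq_cube)
        have "s ^ 3 \<le> exp (s ^ 3)" using exp_ge_add_one_self[of "s ^ 3"] by linarith
        then have "exp (- (s ^ 3)) \<le> 1 / s ^ 3"
          using s \<open>r > 0\<close> by (simp add: exp_minus field_simps)
        then show "norm (1 * exp (- (complex_of_real s ^ 3))) \<le> 1 / s ^ 3"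
          by (simp flip: of_real_power)
      qed
      also have "\<dots> \<le> 1 / (2 * r\<^sup>2)" by simp
      finally show ?case .
    qed
  qed simp
  have arc: "norm (F (of_real L * cis (pi / 6)) - F (of_real L)) \<le> 1 / L\<^sup>2" if "L > 0" for L
  proof -
    \<comment> \<open>Along the arc the derivative of F has modulus L exp(-L^3 cos(3 \<alpha>)), and
      cos(3 \<alpha>) = sin(pi/2 - 3 \<alpha>) is at least half its argument. \<open>?m\<close> is a
      primitive of the resulting bound; differentiating its exponent gives 3 L^3/2, whence the
      factor 2/(3 L^2).\<close>
    let ?m = "\<lambda>\<alpha>. 2 / (3 * L\<^sup>2) * exp (- (L ^ 3 * (pi / 2 - 3 * \<alpha>) / 2))"
    have "norm (F (of_real L * cis (pi / 6)) - F (of_real L * cis 0)) \<le> ?m (pi / 6) - ?m 0"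
    proof (rule differentiable_bound_general)
      show "continuous_on {0..pi / 6} (\<lambda>\<alpha>. F (of_real L * cis \<alpha>))"
        by (intro continuous_on_compose2[OF contF]) (auto intro!: continuous_intros)
      show "continuous_on {0..pi / 6} ?m"
        using that by (auto intro!: continuous_intros)
      fix \<alpha> assume \<alpha>: "0 < \<alpha>" "\<alpha> < pi / 6"
      have "(cis has_vector_derivative \<i> * cis \<alpha>) (at \<alpha>)"
        by (auto intro!: derivative_eq_intros simp: has_vector_derivative_def)
      then show "((\<lambda>\<alpha>. F (of_real L * cis \<alpha>)) has_vector_derivative
          (of_real L * (\<i> * cis \<alpha>)) * exp (- ((of_real L * cis \<alpha>) ^ 3))) (at \<alpha>)"
        by (intro vec) (auto intro!: derivative_eq_intros)
      show "(?m has_vector_derivative L * exp (- (L ^ 3 * (pi / 2 - 3 * \<alpha>) / 2))) (at \<alpha>)"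
        unfolding has_real_derivative_iff_has_vector_derivative[symmetric]
        using that by (auto intro!: derivative_eq_intros simp: field_simps power2_eq_square power3_eq_cube)
      have "(pi / 2 - 3 * \<alpha>) / 2 \<le> sin (pi / 2 - 3 * \<alpha>)"
        using \<alpha> by (intro half_le_sin) auto
      also have "\<dots> = cos (3 * \<alpha>)" by (simp add: sin_diff)
      finally have "L ^ 3 * ((pi / 2 - 3 * \<alpha>) / 2) \<le> L ^ 3 * cos (3 * \<alpha>)"
        using that by (intro mult_left_mono) auto
      then show "norm ((of_real L * (\<i> * cis \<alpha>)) * exp (- ((of_real L * cis \<alpha>) ^ 3)))
          \<le> L * exp (- (L ^ 3 * (pi / 2 - 3 * \<alpha>) / 2))"
        using that by (simp add: norm_mult power_mult_distrib Complex.DeMoivre flip: of_real_power)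
    qed simp
    also have "\<dots> \<le> 2 / (3 * L\<^sup>2)" using that by simp
    also have "\<dots> \<le> 1 / L\<^sup>2" using that by (simp add: field_simps)
    finally show ?thesis by simp
  qed
  have "norm (F (of_real L * cis (pi / 6)) - of_real (Gamma (4/3))) \<le> 2 / L\<^sup>2" if "L > 0" for L
  proof -
    have "norm (F (of_real L * cis (pi / 6)) - of_real (Gamma (4/3))) \<le> 1 / L\<^sup>2 + 1 / (2 * L\<^sup>2)"
      using arc[OF that] tail[OF that] by (intro norm_diff_triangle_le) (auto simp: norm_minus_commute)
    also have "\<dots> \<le> 2 / L\<^sup>2" using that by (simp add: field_simps)
    finally show ?thesis .
  qed
  with that F0 F show thesis by blast
qed

section \<open>The cubic normal form of the phase t - sin t\<close>

text \<open>This is the tangent at h = 1 of h^(5/3), with h = v^3 and a quadratic remainder, in a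
  form free of fractional powers. Both gaps are polynomials in v with a double root at 1 and a
  nonnegative cofactor. It transfers the Taylor expansion of w^3 to w^5.\<close>

lemma fifth_power_linearization:
  fixes v :: real
  assumes "v \<ge> 0"
  shows "\<bar>v ^ 5 - (1 + 5/3 * (v ^ 3 - 1))\<bar> \<le> 2/3 * (v ^ 3 - 1)\<^sup>2"
proof -
  have "0 \<le> (v - 1)\<^sup>2 * (3 * v ^ 3 + 6 * v\<^sup>2 + 4 * v + 2)"
    using assms by simp
  also have "\<dots> = 3 * v ^ 5 - 5 * v ^ 3 + 2"
    by algebra
  finally have lower: "v ^ 5 \<ge> 1 + 5/3 * (v ^ 3 - 1)"
    by (simp add: field_simps)
  have "0 \<le> v ^ 3 * ((v - 1)\<^sup>2 * (2 * v + 1)) / 3"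
    using assms by simp
  also have "\<dots> = 1 + 5/3 * (v ^ 3 - 1) + 2/3 * (v ^ 3 - 1)\<^sup>2 - v ^ 5"
    by (simp add: field_simps) algebra
  finally show ?thesis
    using lower unfolding abs_le_iff by linarith
qed

text \<open>Since t^2 <= 10, the Taylor lower bound divided by t^3 is at least 1 - 1/2 - 5/42 =
  8/21, slightly above 3/8.\<close>

lemma id_minus_sin_ge_cube:
  fixes t :: real
  assumes "0 < t" "t \<le> pi"
  shows "3/8 * t ^ 3 \<le> 6 * (t - sin t)"
proof -
  have "t\<^sup>2 \<le> (3.15)\<^sup>2" using assms pi_approx by (intro power_mono) auto
  then have y: "t\<^sup>2 \<le> 10" by (simp add: power2_eq_square)
  have "6 * (t - sin t) \<ge> t ^ 3 - t ^ 5 / 20 - t ^ 7 / 840"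
    using sin_taylor_bound[of t] assms(1) unfolding abs_le_iff by simp
  moreover have "t ^ 3 - t ^ 5 / 20 - t ^ 7 / 840 = t ^ 3 * (1 - t\<^sup>2 / 20 - t\<^sup>2 * t\<^sup>2 / 840)"
    by (simp add: field_simps flip: power_add)
  moreover have "t\<^sup>2 * t\<^sup>2 \<le> 10 * 10" using y by (intro mult_mono) auto
  then have "t ^ 3 * (1 - t\<^sup>2 / 20 - t\<^sup>2 * t\<^sup>2 / 840) \<ge> t ^ 3 * (3/8)"
    using y assms(1) by (intro mult_left_mono) auto
  ultimately show ?thesis by simp
qed

text \<open>
  The left-hand side is the derivative of \<open>1 / (1 - cos t) - 2 / w\<^sup>2\<close>.  Each term blows up like
  \<open>4 / t\<^sup>3\<close>; boundedness needs the cancellation of the two leading Taylor terms.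
\<close>
lemma normal_form_derivative_bound:
  fixes t w :: real
  assumes t: "0 < t" "t \<le> pi" and w: "w > 0" "w ^ 3 = 6 * (t - sin t)"
  shows "\<bar>- sin t / (1 - cos t)\<^sup>2 + 8 * (1 - cos t) / w ^ 5\<bar> \<le> 8"
proof -
  \<comment> \<open>All of k, q and v are normalised to tend to 1 as t tends to 0. Up to O(y^2), v^3
    is 1 - y/20, k is 1 - y/12 and q is 1 - y/6.\<close>
  define y k q v where "y = t\<^sup>2" and "k = 2 * (1 - cos t) / t\<^sup>2" and "q = sin t / t" and "v = w / t"
  have "t \<le> 3.15" using t pi_approx by simp
  then have "t\<^sup>2 \<le> (3.15)\<^sup>2" using t by (intro power_mono) auto
  then have y: "0 < y" "y \<le> 10" using t by (auto simp: y_def power2_eq_square)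
  have v: "v > 0" using t w by (simp add: v_def)
  have v3: "v ^ 3 = 6 * (t - sin t) / t ^ 3" by (simp add: v_def power_divide w)
  have yy: "y\<^sup>2 \<le> 10 * y" "y\<^sup>2 * y \<le> y\<^sup>2 * 10" "y\<^sup>2 * y\<^sup>2 \<le> y\<^sup>2 * (10 * 10)"
    using y mult_mono[of y 10 y 10] by (auto simp: power2_eq_square intro!: mult_mono)
  have h: "\<bar>v ^ 3 - (1 - y / 20)\<bar> \<le> y\<^sup>2 / 840"
  proof -
    have "v ^ 3 - (1 - y / 20) = - 6 / t ^ 3 * (sin t - (t - t ^ 3 / 6 + t ^ 5 / 120))"
      unfolding v3 y_def using t by (simp add: field_simps flip: power_add)
    also have "\<bar>\<dots>\<bar> = 6 / t ^ 3 * \<bar>sin t - (t - t ^ 3 / 6 + t ^ 5 / 120)\<bar>"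
      unfolding abs_mult using t by simp
    also have "\<dots> \<le> 6 / t ^ 3 * (t ^ 7 / 5040)"
      using sin_taylor_bound[of t] t by (intro mult_left_mono) auto
    also have "\<dots> = y\<^sup>2 / 840"
      unfolding y_def using t by (simp add: field_simps eval_nat_numeral)
    finally show ?thesis .
  qed
  have kk: "\<bar>k - (1 - y / 12)\<bar> \<le> y\<^sup>2 / 360"
  proof -
    have "k - (1 - y / 12) = - 2 / t\<^sup>2 * (cos t - (1 - t ^ 2 / 2 + t ^ 4 / 24))"
      unfolding k_def y_def using t by (simp add: field_simps flip: power_add)
    also have "\<bar>\<dots>\<bar> = 2 / t\<^sup>2 * \<bar>cos t - (1 - t ^ 2 / 2 + t ^ 4 / 24)\<bar>"
      unfolding abs_mult using t by simp
    also have "\<dots> \<le> 2 / t\<^sup>2 * (t ^ 6 / 720)"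
      using cos_taylor_bound[of t] t by (intro mult_left_mono) auto
    also have "\<dots> = y\<^sup>2 / 360"
      unfolding y_def using t by (simp add: field_simps eval_nat_numeral)
    finally show ?thesis .
  qed
  have qq: "\<bar>q - (1 - y / 6)\<bar> \<le> y\<^sup>2 / 90"
  proof -
    have "q - (1 - y / 6) - y\<^sup>2 / 120 = 1 / t * (sin t - (t - t ^ 3 / 6 + t ^ 5 / 120))"
      unfolding q_def y_def using t by (simp add: field_simps eval_nat_numeral)
    also have "\<bar>\<dots>\<bar> = 1 / t * \<bar>sin t - (t - t ^ 3 / 6 + t ^ 5 / 120)\<bar>"
      unfolding abs_mult using t by simp
    also have "\<dots> \<le> 1 / t * (t ^ 7 / 5040)"
      using sin_taylor_bound[of t] t by (intro mult_left_mono) auto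
    also have "\<dots> = y\<^sup>2 * y / 5040"
      unfolding y_def using t by (simp add: field_simps eval_nat_numeral)
    finally show ?thesis using yy by linarith
  qed
  have k4: "k \<ge> 1/4"
  proof -
    have "t / 2 / 2 \<le> sin (t / 2)" using t by (intro half_le_sin) auto
    then have "(t / 2 / 2)\<^sup>2 \<le> (sin (t / 2))\<^sup>2" using t by (intro power_mono) auto
    moreover have "cos t = 1 - 2 * (sin (t / 2))\<^sup>2" using cos_double_sin[of "t / 2"] by simp
    ultimately show ?thesis using t by (simp add: k_def field_simps)
  qed
  \<comment> \<open>With y <= 10 the expansion of v^3 puts it between 3/8 and 1. Hence v <= 1 and
    v^5 >= v^6 >= 9/64.\<close>
  have v5: "v ^ 5 \<ge> 1/8"
  proof -
    have v38: "v ^ 3 \<ge> 3/8" and "v ^ 3 \<le> 1" using h yy y by linarith+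
    then have "v \<le> 1" using v power_le_one_iff[of v 3] by simp
    then have "v ^ 6 \<le> v ^ 5" using v by (intro power_decreasing) auto
    moreover have "v ^ 6 = (v ^ 3)\<^sup>2" by (simp flip: power_mult)
    moreover have "(v ^ 3)\<^sup>2 \<ge> (3/8)\<^sup>2" using v38 by (intro power_mono) auto
    moreover have "(3/8)\<^sup>2 \<ge> (1/8 :: real)" by (simp add: power2_eq_square)
    ultimately show ?thesis by linarith
  qed
  \<comment> \<open>The linear terms cancel because 5/3 * 1/20 = 1/12.\<close>
  have num1: "\<bar>k - v ^ 5\<bar> \<le> y\<^sup>2 / 100"
  proof -
    have "\<bar>v ^ 3 - 1\<bar> \<le> y / 16" using h yy y by linarith
    then have "(v ^ 3 - 1)\<^sup>2 \<le> (y / 16)\<^sup>2" using y by (subst abs_le_square_iff[symmetric]) auto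
    then have "(v ^ 3 - 1)\<^sup>2 \<le> y\<^sup>2 / 256" by (simp add: power_divide)
    then have "2/3 * (v ^ 3 - 1)\<^sup>2 \<le> 2/3 * (y\<^sup>2 / 256)" by simp
    with fifth_power_linearization[OF less_imp_le[OF v]]
    have "\<bar>v ^ 5 - (1 + 5/3 * (v ^ 3 - 1))\<bar> \<le> 2/3 * (y\<^sup>2 / 256)"
      by (rule order_trans)
    then show ?thesis
      using h kk zero_le_power2[of y] by argo
  qed
  \<comment> \<open>Squaring 1 - y/12 reproduces the linear term of q, since 2/12 = 1/6.\<close>
  have num2: "\<bar>q - k\<^sup>2\<bar> \<le> y\<^sup>2 / 35"
  proof -
    define e where "e = k - (1 - y / 12)"
    have e: "\<bar>e\<bar> \<le> y\<^sup>2 / 360" using kk by (simp add: e_def)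
    have "k\<^sup>2 - (1 - y / 6) = y\<^sup>2 / 144 + 2 * (e * (1 - y / 12)) + e\<^sup>2"
      by (simp add: e_def power2_eq_square field_simps)
    moreover have "\<bar>e * (1 - y / 12)\<bar> \<le> y\<^sup>2 / 360 * 1"
      unfolding abs_mult using e y by (intro mult_mono) auto
    moreover have "e\<^sup>2 \<le> (y\<^sup>2 / 360)\<^sup>2" using e by (subst abs_le_square_iff[symmetric]) auto
    then have "e\<^sup>2 \<le> y\<^sup>2 * y\<^sup>2 / 129600" by (simp add: power2_eq_square)
    then have "e\<^sup>2 \<le> y\<^sup>2 / 1000" using yy zero_le_power2[of y] by linarith
    moreover have "e\<^sup>2 \<ge> 0" by simp
    ultimately show ?thesis
      using qq zero_le_power2[of y] by argo
  qed
  \<comment> \<open>The singular factor 4/t^3 now multiplies differences of order y^2 = t^4, so a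
    bounded multiple of t remains.\<close>
  have "- sin t / (1 - cos t)\<^sup>2 + 8 * (1 - cos t) / w ^ 5 = 4 / t ^ 3 * ((k - v ^ 5) / v ^ 5 - (q - k\<^sup>2) / k\<^sup>2)"
  proof -
    have c: "1 - cos t = k * t\<^sup>2 / 2" and s: "sin t = q * t" and w': "w = v * t"
      using t by (auto simp: k_def q_def v_def)
    show ?thesis unfolding c s w' using t v k4
      by (simp add: field_simps eval_nat_numeral)
  qed
  also have "\<bar>\<dots>\<bar> \<le> 4 / t ^ 3 * (y\<^sup>2 / 100 / (1/8) + y\<^sup>2 / 35 / (1/16))"
  proof -
    have "\<bar>(k - v ^ 5) / v ^ 5\<bar> \<le> y\<^sup>2 / 100 / (1/8)"
      unfolding abs_divide using num1 v5 by (intro frac_le) auto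
    moreover have "k\<^sup>2 \<ge> (1/4)\<^sup>2" using k4 by (intro power_mono) auto
    then have "\<bar>(q - k\<^sup>2) / k\<^sup>2\<bar> \<le> y\<^sup>2 / 35 / (1/16)"
      unfolding abs_divide using num2 by (intro frac_le) (auto simp: power2_eq_square)
    ultimately have "\<bar>(k - v ^ 5) / v ^ 5 - (q - k\<^sup>2) / k\<^sup>2\<bar> \<le> y\<^sup>2 / 100 / (1/8) + y\<^sup>2 / 35 / (1/16)"
      by (rule order.trans[OF abs_triangle_ineq4 add_mono])
    then have "4 / t ^ 3 * \<bar>(k - v ^ 5) / v ^ 5 - (q - k\<^sup>2) / k\<^sup>2\<bar> \<le> 4 / t ^ 3 * (y\<^sup>2 / 100 / (1/8) + y\<^sup>2 / 35 / (1/16))"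
      using t by (intro mult_left_mono) auto
    moreover have "\<bar>4 / t ^ 3\<bar> = 4 / t ^ 3" using t by simp
    ultimately show ?thesis by (simp only: abs_mult)
  qed
  also have "\<dots> = t * (4 * (8 / 100 + 16 / 35))"
    unfolding y_def using t by (simp add: field_simps eval_nat_numeral)
  also have "\<dots> \<le> 3.15 * (4 * (8 / 100 + 16 / 35))"
    using \<open>t \<le> 3.15\<close> by (intro mult_right_mono) auto
  also have "\<dots> \<le> 8" by simp
  finally show ?thesis .
qed

definition phase_root :: "real \<Rightarrow> real" where
  "phase_root t = root 3 (6 * (t - sin t))"

lemma phase_root_cube: "phase_root t ^ 3 = 6 * (t - sin t)"
  by (simp add: phase_root_def odd_real_root_pow)

lemma phase_root_pos: "0 < t \<Longrightarrow> t \<le> pi \<Longrightarrow> phase_root t > 0"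
proof -
  assume t: "0 < t" "t \<le> pi"
  then have "0 < 3/8 * t ^ 3" by simp
  then have "0 < 6 * (t - sin t)" using id_minus_sin_ge_cube[OF t] by linarith
  then show ?thesis by (simp add: phase_root_def)
qed

lemma phase_root_0 [simp]: "phase_root 0 = 0"
  by (simp add: phase_root_def)

lemma continuous_on_phase_root: "continuous_on A phase_root"
  unfolding phase_root_def by (intro continuous_intros)

lemma phase_root_deriv:
  assumes "0 < t" "t \<le> pi"
  shows "(phase_root has_real_derivative 2 * (1 - cos t) / (phase_root t)\<^sup>2) (at t)"
proof -
  have "6 * (t - sin t) > 0" using phase_root_pos[OF assms] by (simp add: phase_root_def)
  then show ?thesis
    unfolding phase_root_def
    by (auto intro!: derivative_eq_intros DERIV_real_root simp: field_simps)
qed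

text \<open>This is \<open>(1 - w') / (1 - cos t)\<close> for \<open>w = phase_root t\<close>, because \<open>w' = 2 (1 - cos t) / w\<^sup>2\<close>.\<close>
definition normal_form_defect :: "real \<Rightarrow> real" where
  "normal_form_defect t = 1 / (1 - cos t) - 2 / (phase_root t)\<^sup>2"

lemma cos_less_1: "0 < t \<Longrightarrow> t \<le> pi \<Longrightarrow> cos t < 1"
  using cos_monotone_0_pi[of 0 t] by simp

lemma normal_form_defect_deriv:
  assumes t: "0 < t" "t \<le> pi"
  shows "(normal_form_defect has_real_derivative
    (- sin t / (1 - cos t)\<^sup>2 + 8 * (1 - cos t) / phase_root t ^ 5)) (at t)"
  unfolding normal_form_defect_def using phase_root_pos[OF t] cos_less_1[OF t]
  by (auto intro!: derivative_eq_intros phase_root_deriv t simp: field_simps eval_nat_numeral)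

text \<open>The derivative bound 8 is integrated backwards from pi, so no limit at the singular
  point 0 is required. The constant covers 8 * 3.2 + 1/2.\<close>

lemma normal_form_defect_bound:
  assumes t: "0 < t" "t \<le> pi"
  shows "\<bar>normal_form_defect t\<bar> \<le> 27"
proof -
  let ?D = "\<lambda>t. - sin t / (1 - cos t)\<^sup>2 + 8 * (1 - cos t) / phase_root t ^ 5"
  have "norm (normal_form_defect t - normal_form_defect pi) \<le> 8 * norm (t - pi)"
  proof (rule field_differentiable_bound)
    show "(normal_form_defect has_real_derivative ?D s) (at s within {t..pi})" if "s \<in> {t..pi}" for s
      using that t by (intro has_field_derivative_at_within[OF normal_form_defect_deriv]) auto
    show "norm (?D s) \<le> 8" if "s \<in> {t..pi}" for s
      unfolding real_norm_def using that t
      by (intro normal_form_derivative_bound phase_root_pos phase_root_cube) auto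
  qed (use t in auto)
  also have "\<dots> \<le> 8 * 3.2" using t pi_approx by simp
  finally have "\<bar>normal_form_defect t - normal_form_defect pi\<bar> \<le> 8 * 3.2" by simp
  \<comment> \<open>At pi the defect is 1/2 - 2/w^2, and w >= 2 because w^3 = 6 pi exceeds
    8.\<close>
  moreover have "\<bar>normal_form_defect pi\<bar> \<le> 1/2"
  proof -
    have "2 ^ 3 \<le> phase_root pi ^ 3" using pi_approx by (simp add: phase_root_cube)
    then have "2 \<le> phase_root pi" using power_mono_iff[of 2 "phase_root pi" 3] phase_root_pos[of pi] by simp
    then have "2 / (phase_root pi)\<^sup>2 \<le> 2 / 2\<^sup>2" by (intro divide_left_mono power_mono) auto
    then show ?thesis by (simp add: normal_form_defect_def)
  qed
  ultimately show ?thesis by argo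
qed

section \<open>Integration by parts in the remainder\<close>

text \<open>The condition on l gives (l w)^3 = i x (t - sin t) for w = \<open>phase_root t\<close>.
  Hence F(l w) / (l \<rho>^2) is a primitive of the oscillating factor times w'/\<rho>^2, and only
  the amplitude (1 - cos t) D(t) is left to estimate.\<close>

lemma oscillatory_estimate:
  fixes F :: "complex \<Rightarrow> complex" and l :: complex and x \<rho> :: real
  assumes F: "F 0 = 0" "\<And>z. (F has_field_derivative exp (- (z ^ 3))) (at z)"
    and l: "l ^ 3 = \<i> * x / 6" and x: "x > 0" and \<rho>: "\<rho> > 0"
  shows "norm (integral {0..pi} (\<lambda>t. exp (- (\<i> * (x * (t - sin t)))) / of_real (\<rho>\<^sup>2 + (sin t)\<^sup>2))
      - F (l * phase_root pi) / (l * of_real (\<rho>\<^sup>2))) \<le> 110 * (1 / \<rho>\<^sup>2 + 1 / \<rho> ^ 4) / x"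
proof -
  define E where "E t = exp (- (\<i> * (x * (t - sin t))))" for t :: real
  define g where "g t = \<rho>\<^sup>2 + (sin t)\<^sup>2" for t :: real
  define I where "I T = integral {0..T} (\<lambda>t. E t / of_real (g t))" for T
  define Z where "Z T = I T - F (l * phase_root T) / (l * of_real (\<rho>\<^sup>2))" for T
  define D where "D t = (normal_form_defect t - (1 + cos t) / g t) / \<rho>\<^sup>2" for t
  define D' where "D' t = ((- sin t / (1 - cos t)\<^sup>2 + 8 * (1 - cos t) / phase_root t ^ 5)
      + sin t / g t + 2 * (1 + cos t) * sin t * cos t / (g t)\<^sup>2) / \<rho>\<^sup>2" for t
  \<comment> \<open>\<open>Z\<close> corrected by the boundary term of the integration by parts, so that \<open>Y' = E D' / (i x)\<close>.\<close>
  define Y where "Y t = Z t + E t * of_real (D t) / (\<i> * x)" for t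
  have l0: "l \<noteq> 0" using l x by auto
  have g: "g t \<ge> \<rho>\<^sup>2" "g t > 0" for t
    using \<rho> by (auto simp: g_def intro: add_pos_nonneg)
  have g0: "g t \<noteq> 0" for t using g(2)[of t] by simp
  have contg: "continuous_on A g" for A
    unfolding g_def by (intro continuous_intros)
  have g_deriv: "(g has_real_derivative 2 * sin t * cos t) (at t)" for t
    unfolding g_def[abs_def] by (auto intro!: derivative_eq_intros)
  have normE: "norm (E t) = 1" for t by (simp add: E_def)
  have contf: "continuous_on A (\<lambda>t. E t / of_real (g t))" for A
    unfolding E_def using g0 by (intro continuous_intros contg) auto
  have contI: "continuous_on {0..pi} I"
    unfolding I_def by (intro indefinite_integral_continuous_1 integrable_continuous_real contf)
  have contF: "continuous_on A F" for A
    by (intro continuous_at_imp_continuous_on ballI DERIV_isCont[OF F(2)])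
  have contZ: "continuous_on {0..pi} Z"
    unfolding Z_def using l0 \<rho>
    by (intro continuous_intros contI continuous_on_compose2[OF contF] continuous_on_phase_root) auto
  have Z0: "Z 0 = 0" by (simp add: Z_def I_def F)
  have Y_deriv: "(Y has_vector_derivative E t * of_real (D' t) / (\<i> * x)) (at t)" if t: "0 < t" "t < pi" for t
  proof -
    let ?w = "phase_root t" and ?w' = "2 * (1 - cos t) / (phase_root t)\<^sup>2"
    have w: "?w > 0" "cos t < 1" using t phase_root_pos cos_less_1 by auto
    have "(I has_vector_derivative E t / of_real (g t)) (at t within {0..pi})"
      unfolding I_def using t by (intro integral_has_vector_derivative contf) auto
    then have I': "(I has_vector_derivative E t / of_real (g t)) (at t)"
      using t by (subst (asm) at_within_interior) auto
    have "((\<lambda>t. l * of_real (phase_root t)) has_vector_derivative l * of_real ?w') (at t)"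
      using phase_root_deriv[of t] t
      by (intro has_vector_derivative_mult_right has_vector_derivative_of_real)
         (auto simp: has_real_derivative_iff_has_vector_derivative)
    from field_vector_diff_chain_at[OF this F(2)]
    have "((\<lambda>t. F (l * of_real (phase_root t))) has_vector_derivative
        l * of_real ?w' * exp (- ((l * of_real ?w) ^ 3))) (at t)"
      by (simp only: o_def)
    moreover have "exp (- ((l * of_real ?w) ^ 3)) = E t"
    proof -
      have "(l * of_real ?w) ^ 3 = l ^ 3 * of_real (?w ^ 3)" by (simp add: power_mult_distrib)
      also have "\<dots> = \<i> * (x * (t - sin t))" by (simp add: l phase_root_cube)
      finally show ?thesis by (simp add: E_def)
    qed
    ultimately have F': "((\<lambda>t. F (l * of_real (phase_root t))) has_vector_derivative
        l * of_real ?w' * E t) (at t)" by simp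
    have "((\<lambda>t. F (l * of_real (phase_root t)) * (1 / (l * of_real (\<rho>\<^sup>2)))) has_vector_derivative
        (l * of_real ?w' * E t) * (1 / (l * of_real (\<rho>\<^sup>2)))) (at t)"
      by (rule has_vector_derivative_mult_left[OF F'])
    then have FF': "((\<lambda>t. F (l * of_real (phase_root t)) / (l * of_real (\<rho>\<^sup>2))) has_vector_derivative
        of_real (?w' / \<rho>\<^sup>2) * E t) (at t)"
      using l0 by simp
    have E': "(E has_vector_derivative - (\<i> * x * of_real (1 - cos t)) * E t) (at t)"
    proof -
      have "((\<lambda>t. x * (t - sin t)) has_real_derivative x * (1 - cos t)) (at t)"
        by (auto intro!: derivative_eq_intros)
      then have "((\<lambda>t. complex_of_real (x * (t - sin t))) has_vector_derivative of_real (x * (1 - cos t))) (at t)"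
        by (intro has_vector_derivative_of_real) (simp add: has_real_derivative_iff_has_vector_derivative)
      then have "((\<lambda>t. - \<i> * complex_of_real (x * (t - sin t))) has_vector_derivative - \<i> * of_real (x * (1 - cos t))) (at t)"
        by (rule has_vector_derivative_mult_right)
      from field_vector_diff_chain_at[OF this DERIV_exp]
      show ?thesis by (simp add: o_def E_def[abs_def] mult_ac)
    qed
    have "(D has_real_derivative D' t) (at t)"
      unfolding D_def[abs_def] D'_def using t g0[of t] \<rho>
      by (auto intro!: derivative_eq_intros normal_form_defect_deriv g_deriv
           simp: field_simps power2_eq_square)
    then have D': "((\<lambda>t. complex_of_real (D t)) has_vector_derivative of_real (D' t)) (at t)"
      by (intro has_vector_derivative_of_real) (simp add: has_real_derivative_iff_has_vector_derivative)
    have "((\<lambda>t. E t * complex_of_real (D t) * (1 / (\<i> * x))) has_vector_derivative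
        (E t * of_real (D' t) + - (\<i> * x * of_real (1 - cos t)) * E t * of_real (D t)) * (1 / (\<i> * x))) (at t)"
      by (intro has_vector_derivative_mult_left has_vector_derivative_mult E' D')
    moreover have "(E t * of_real (D' t) + - (\<i> * x * of_real (1 - cos t)) * E t * of_real (D t)) * (1 / (\<i> * x))
      = E t * of_real (D' t) / (\<i> * x) - E t * of_real ((1 - cos t) * D t)"
      using x by (simp add: field_simps)
    ultimately have ED': "((\<lambda>t. E t * complex_of_real (D t) / (\<i> * x)) has_vector_derivative
        E t * of_real (D' t) / (\<i> * x) - E t * of_real ((1 - cos t) * D t)) (at t)"
      by simp
    \<comment> \<open>Multiplication by 1 - cos t turns the defect into 1 - w' and (1 + cos t)/g
      into sin^2 t / g = 1 - \<rho>^2/g, so the constants 1 cancel.\<close>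
    have key: "1 / g t - ?w' / \<rho>\<^sup>2 = (1 - cos t) * D t"
    proof -
      have "(1 - cos t) * (1 + cos t) = (sin t)\<^sup>2"
        by (simp add: sin_squared_eq algebra_simps power2_eq_square)
      then have "(1 - cos t) * D t = ((1 - cos t) * normal_form_defect t - (sin t)\<^sup>2 / g t) / \<rho>\<^sup>2"
        by (simp add: D_def algebra_simps)
      also have "(1 - cos t) * normal_form_defect t = 1 - ?w'"
        using w by (simp add: normal_form_defect_def field_simps)
      also have "(sin t)\<^sup>2 / g t = 1 - \<rho>\<^sup>2 / g t"
        using g(2)[of t] by (subst eq_diff_eq, subst add_divide_distrib[symmetric]) (use \<rho> in \<open>simp add: g_def add.commute\<close>)
      also have "(1 - ?w' - (1 - \<rho>\<^sup>2 / g t)) / \<rho>\<^sup>2 = 1 / g t - ?w' / \<rho>\<^sup>2"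
      proof -
        have "(1 - v - (1 - \<rho>\<^sup>2 / g t)) / \<rho>\<^sup>2 = 1 / g t - v / \<rho>\<^sup>2" for v
          using \<rho> by (simp add: diff_divide_distrib)
        then show ?thesis .
      qed
      finally show ?thesis by (rule sym)
    qed
    have "(Y has_vector_derivative E t / of_real (g t) - of_real (?w' / \<rho>\<^sup>2) * E t
        + (E t * of_real (D' t) / (\<i> * x) - E t * of_real ((1 - cos t) * D t))) (at t)"
      unfolding Y_def[abs_def] Z_def
      by (intro has_vector_derivative_add has_vector_derivative_diff I' FF' ED')
    moreover have "E t / of_real (g t) - of_real (?w' / \<rho>\<^sup>2) * E t = E t * of_real ((1 - cos t) * D t)"
      unfolding key[symmetric] by (simp add: algebra_simps divide_simps)
    ultimately show ?thesis by simp
  qed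
  \<comment> \<open>\<open>\<sigma>\<close> is the sign of \<open>cos\<close>, on which the monotonicity of \<open>1 / g\<close> depends.\<close>
  have step: "norm (Y b - Y a) \<le> (4 / \<rho>\<^sup>2 + 8 * pi) / (x * \<rho>\<^sup>2)"
    if ab: "0 < a" "a < b" "b \<le> pi" and \<sigma>: "\<sigma>\<^sup>2 = 1" "\<And>t. a < t \<Longrightarrow> t < b \<Longrightarrow> \<sigma> * cos t \<ge> 0" for a b \<sigma> :: real
  proof -
    \<comment> \<open>m is a primitive of a bound for the modulus of Y'. Its three terms account in
      order for sin t / g, for the term with 1/g^2 (using 1 + cos t <= 2), and for the derivative of
      the defect, bounded by 8.\<close>
    define m where "m t = (- cos t / \<rho>\<^sup>2 - 2 * \<sigma> / g t + 8 * t) / (x * \<rho>\<^sup>2)" for t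
    have \<sigma>1: "\<sigma> = 1 \<or> \<sigma> = -1" using \<sigma>(1) by (simp add: power2_eq_1_iff)
    have "norm (Y b - Y a) \<le> m b - m a"
    proof (rule differentiable_bound_general[OF ab(2)])
      have "continuous_on {a..b} normal_form_defect"
        using ab by (intro continuous_at_imp_continuous_on ballI DERIV_isCont[OF normal_form_defect_deriv]) auto
      then have "continuous_on {a..b} D"
        unfolding D_def using g0 \<rho> by (intro continuous_intros contg) auto
      then show "continuous_on {a..b} Y"
        unfolding Y_def E_def using ab x
        by (intro continuous_intros continuous_on_subset[OF contZ]) auto
      show "continuous_on {a..b} m"
        unfolding m_def using g0 \<rho> x by (intro continuous_intros contg) auto
      fix t assume t: "a < t" "t < b"
      show "(Y has_vector_derivative E t * of_real (D' t) / (\<i> * x)) (at t)"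
        using t ab by (intro Y_deriv) auto
      show "(m has_vector_derivative
          (sin t / \<rho>\<^sup>2 + 4 * sin t * (\<sigma> * cos t) / (g t)\<^sup>2 + 8) / (x * \<rho>\<^sup>2)) (at t)"
        unfolding m_def[abs_def] has_real_derivative_iff_has_vector_derivative[symmetric]
        using g0[of t] \<rho> x
        by (auto intro!: derivative_eq_intros g_deriv simp: field_simps power2_eq_square)
      have sin: "sin t \<ge> 0" using t ab by (intro sin_ge_zero) auto
      have "\<bar>sin t / g t\<bar> \<le> sin t / \<rho>\<^sup>2"
        using sin g[of t] \<rho> by (auto intro!: divide_left_mono)
      moreover have "\<bar>2 * (1 + cos t) * sin t * cos t / (g t)\<^sup>2\<bar> \<le> 4 * sin t * (\<sigma> * cos t) / (g t)\<^sup>2"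
      proof -
        have "\<bar>1 + cos t\<bar> \<le> 2"
          using cos_le_one[of t] cos_ge_minus_one[of t] by linarith
        then have le: "2 * \<bar>1 + cos t\<bar> * (sin t * \<bar>cos t\<bar>) \<le> 2 * 2 * (sin t * \<bar>cos t\<bar>)"
          using sin by (intro mult_right_mono mult_left_mono) auto
        have "\<bar>2 * (1 + cos t) * sin t * cos t\<bar> = 2 * \<bar>1 + cos t\<bar> * (sin t * \<bar>cos t\<bar>)"
          using sin by (simp only: abs_mult)
        also note le
        also have "\<bar>cos t\<bar> = \<sigma> * cos t" using \<sigma>(2)[OF t] \<sigma>1 by auto
        finally show ?thesis by (simp add: divide_right_mono)
      qed
      moreover have "\<bar>- sin t / (1 - cos t)\<^sup>2 + 8 * (1 - cos t) / phase_root t ^ 5\<bar> \<le> 8"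
        using t ab by (intro normal_form_derivative_bound phase_root_pos phase_root_cube) auto
      moreover have "\<bar>p + q + r\<bar> \<le> Q + R + P"
        if "\<bar>q\<bar> \<le> Q" "\<bar>r\<bar> \<le> R" "\<bar>p\<bar> \<le> P" for p q r P Q R :: real
        using that by linarith
      ultimately have "\<bar>\<rho>\<^sup>2 * D' t\<bar> \<le> sin t / \<rho>\<^sup>2 + 4 * sin t * (\<sigma> * cos t) / (g t)\<^sup>2 + 8"
        using \<rho> unfolding D'_def by simp
      then have "\<bar>D' t\<bar> \<le> (sin t / \<rho>\<^sup>2 + 4 * sin t * (\<sigma> * cos t) / (g t)\<^sup>2 + 8) / \<rho>\<^sup>2"
        using \<rho> by (simp add: abs_mult pos_le_divide_eq mult.commute)
      from divide_right_mono[OF this, of x]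
      show "norm (E t * of_real (D' t) / (\<i> * x))
          \<le> (sin t / \<rho>\<^sup>2 + 4 * sin t * (\<sigma> * cos t) / (g t)\<^sup>2 + 8) / (x * \<rho>\<^sup>2)"
        using x by (simp add: norm_mult norm_divide normE mult.commute)
    qed
    \<comment> \<open>Both cos/\<rho>^2 and 2/g change by at most 2/\<rho>^2, the latter because 1/g
      stays between 0 and 1/\<rho>^2; the linear term contributes at most 8 pi.\<close>
    also have "\<dots> \<le> (4 / \<rho>\<^sup>2 + 8 * pi) / (x * \<rho>\<^sup>2)"
    proof -
      have "\<bar>1 / g b - 1 / g a\<bar> \<le> 1 / \<rho>\<^sup>2"
      proof -
        have "0 \<le> 1 / g t" "1 / g t \<le> 1 / \<rho>\<^sup>2" for t
          using g[of t] \<rho> by (auto intro!: divide_left_mono)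
        from this[of a] this[of b] show ?thesis by linarith
      qed
      then have "- 2 * \<sigma> / g b + 2 * \<sigma> / g a \<le> 2 / \<rho>\<^sup>2"
        using \<sigma>1 by (auto simp: abs_le_iff)
      moreover have "cos a / \<rho>\<^sup>2 - cos b / \<rho>\<^sup>2 \<le> 2 / \<rho>\<^sup>2"
      proof -
        have "cos a - cos b \<le> 2" using cos_le_one[of a] cos_ge_minus_one[of b] by linarith
        then show ?thesis by (simp add: divide_right_mono flip: diff_divide_distrib)
      qed
      ultimately have "(- cos b / \<rho>\<^sup>2 - 2 * \<sigma> / g b + 8 * b) - (- cos a / \<rho>\<^sup>2 - 2 * \<sigma> / g a + 8 * a)
         \<le> 4 / \<rho>\<^sup>2 + 8 * pi"
        using ab by simp
      then show ?thesis
        unfolding m_def diff_divide_distrib[symmetric] using x by (intro divide_right_mono) auto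
    qed
    finally show ?thesis .
  qed
  have D_bound: "norm (E t * of_real (D t) / (\<i> * x)) \<le> (27 + 2 / \<rho>\<^sup>2) / (x * \<rho>\<^sup>2)" if t: "0 < t" "t \<le> pi" for t
  proof -
    have "\<bar>(1 + cos t) / g t\<bar> \<le> 2 / \<rho>\<^sup>2"
    proof -
      have "\<bar>1 + cos t\<bar> \<le> 2" using cos_le_one[of t] cos_ge_minus_one[of t] by linarith
      then show ?thesis unfolding abs_divide using g[of t] \<rho> by (intro frac_le) auto
    qed
    then have "\<bar>normal_form_defect t - (1 + cos t) / g t\<bar> \<le> 27 + 2 / \<rho>\<^sup>2"
      using normal_form_defect_bound[OF t] by linarith
    then have "\<bar>normal_form_defect t - (1 + cos t) / g t\<bar> / (x * \<rho>\<^sup>2) \<le> (27 + 2 / \<rho>\<^sup>2) / (x * \<rho>\<^sup>2)"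
      using x by (intro divide_right_mono) auto
    moreover have "norm (E t * of_real (D t) / (\<i> * x)) = \<bar>D t\<bar> / x"
      using x by (simp add: norm_mult norm_divide normE)
    moreover have "\<bar>D t\<bar> / x = \<bar>normal_form_defect t - (1 + cos t) / g t\<bar> / (x * \<rho>\<^sup>2)"
      by (simp add: D_def mult.commute)
    ultimately show ?thesis by simp
  qed
  \<comment> \<open>Two applications of \<open>step\<close>, on either side of pi/2, and the two
    boundary terms at \<delta> and pi.\<close>
  define K where "K = (4 / \<rho>\<^sup>2 + 8 * pi) / (x * \<rho>\<^sup>2) + (4 / \<rho>\<^sup>2 + 8 * pi) / (x * \<rho>\<^sup>2)
    + ((27 + 2 / \<rho>\<^sup>2) / (x * \<rho>\<^sup>2) + (27 + 2 / \<rho>\<^sup>2) / (x * \<rho>\<^sup>2))"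
  have Z_bound: "norm (Z pi - Z \<delta>) \<le> K" if \<delta>: "0 < \<delta>" "\<delta> < pi / 2" for \<delta>
  proof -
    have cos: "cos t \<le> 0" if "pi / 2 < t" "t < pi" for t
      using cos_monotone_0_pi_le[of "pi/2" t] that by simp
    have "norm (Y pi - Y (pi / 2)) \<le> (4 / \<rho>\<^sup>2 + 8 * pi) / (x * \<rho>\<^sup>2)"
      by (intro step[where \<sigma> = "-1"]) (simp_all add: cos)
    moreover have "norm (Y (pi / 2) - Y \<delta>) \<le> (4 / \<rho>\<^sup>2 + 8 * pi) / (x * \<rho>\<^sup>2)"
      using \<delta> by (intro step[where \<sigma> = 1]) (auto intro!: cos_ge_zero)
    ultimately have Y_le: "norm (Y pi - Y \<delta>) \<le> (4 / \<rho>\<^sup>2 + 8 * pi) / (x * \<rho>\<^sup>2) + (4 / \<rho>\<^sup>2 + 8 * pi) / (x * \<rho>\<^sup>2)"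
      by (rule norm_diff_triangle_le)
    have "Z pi - Z \<delta> = (Y pi - Y \<delta>) - (E pi * of_real (D pi) / (\<i> * x) - E \<delta> * of_real (D \<delta>) / (\<i> * x))"
      by (simp add: Y_def)
    then have Z_le: "norm (Z pi - Z \<delta>) \<le> norm (Y pi - Y \<delta>)
        + norm (E pi * of_real (D pi) / (\<i> * x) - E \<delta> * of_real (D \<delta>) / (\<i> * x))"
      by (simp only: norm_triangle_ineq4)
    have E_le: "norm (E pi * of_real (D pi) / (\<i> * x) - E \<delta> * of_real (D \<delta>) / (\<i> * x))
        \<le> (27 + 2 / \<rho>\<^sup>2) / (x * \<rho>\<^sup>2) + (27 + 2 / \<rho>\<^sup>2) / (x * \<rho>\<^sup>2)"
      using \<delta> by (intro order.trans[OF norm_triangle_ineq4 add_mono] D_bound) auto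
    show ?thesis
      unfolding K_def by (rule order.trans[OF Z_le add_mono[OF Y_le E_le]])
  qed
  have "norm (Z pi - Z 0) \<le> K"
  proof (rule tendsto_upperbound)
    have "(Z \<longlongrightarrow> Z 0) (at 0 within {0..pi})"
      using contZ by (auto simp: continuous_on_def)
    then have "(Z \<longlongrightarrow> Z 0) (at_right 0)"
      by (simp add: at_within_Icc_at_right)
    then show "((\<lambda>\<delta>. norm (Z pi - Z \<delta>)) \<longlongrightarrow> norm (Z pi - Z 0)) (at_right 0)"
      by (intro tendsto_intros)
    show "\<forall>\<^sub>F \<delta> in at_right 0. norm (Z pi - Z \<delta>) \<le> K"
      by (rule eventually_mono[OF eventually_at_right_real[of 0 "pi / 2"]]) (auto intro: Z_bound)
  qed auto
  also have "K \<le> 110 * (1 / \<rho>\<^sup>2 + 1 / \<rho> ^ 4) / x"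
  proof -
    \<comment> \<open>The constant 110 comes from 16 pi + 54 < 110.\<close>
    have "K = (12 * (1 / \<rho> ^ 4) + (16 * pi + 54) * (1 / \<rho>\<^sup>2)) / x"
      unfolding K_def using x \<rho> by (simp add: field_simps eval_nat_numeral)
    also have "\<dots> \<le> (110 * (1 / \<rho> ^ 4) + 110 * (1 / \<rho>\<^sup>2)) / x"
      using x \<rho> pi_approx by (intro divide_right_mono add_mono mult_right_mono) auto
    finally show ?thesis by (simp add: algebra_simps)
  qed
  finally have "norm (Z pi) \<le> 110 * (1 / \<rho>\<^sup>2 + 1 / \<rho> ^ 4) / x"
    by (simp only: Z0 diff_zero)
  then show ?thesis by (simp only: Z_def I_def E_def g_def)
qed

section \<open>Comparison of H with its main term\<close>

lemma integral_flip:
  fixes f :: "real \<Rightarrow> real"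
  shows "integral {0..c} (\<lambda>t. f (c - t)) = integral {0..c} f"
proof -
  have "integral {0..c} f = integral {-c..-0} (\<lambda>t. f (- t))"
    by (rule Henstock_Kurzweil_Integration.integral_reflect_real[symmetric])
  also have "\<dots> = integral {0..c} (\<lambda>t. f (c - t))"
    using integral_shift_Icc_real[of 0 c "\<lambda>t. f (- t)" "- c"] by (simp add: o_def)
  finally show ?thesis by simp
qed

text \<open>With c = (x/6)^(1/3) and l = c cis(pi/6), replacing F(l p) by Gamma(4/3) costs a
  multiple of 1/(c^2 \<rho>^2 c), and c^3 = x/6 makes this of order 1/(x \<rho>^2), no worse than
  the integration by parts. The bound keeps both powers of \<rho>, so that one estimate serves small
  and large \<rho> alike.\<close>

lemma good_H_error_bound:
  obtains K where "K > 0"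
    "\<And>x \<rho>. x > 0 \<Longrightarrow> \<rho> > 0 \<Longrightarrow> \<bar>good_H x \<rho> - good_main x \<rho>\<bar> \<le> K * (1 / \<rho>\<^sup>2 + 1 / \<rho> ^ 4) / x"
proof -
  obtain F and C :: real where F: "F 0 = 0" "\<And>z. (F has_field_derivative exp (- (z ^ 3))) (at z)"
    and C: "\<And>L. L > 0 \<Longrightarrow> norm (F (of_real L * cis (pi / 6)) - of_real (Gamma (4/3))) \<le> C / L\<^sup>2"
    using exp_neg_cube_primitive by blast
  define p where "p = phase_root pi"
  define K where "K = 110 + 6 * \<bar>C\<bar> / p\<^sup>2"
  have p: "p > 0" by (simp add: p_def phase_root_pos)
  have "\<bar>good_H x \<rho> - good_main x \<rho>\<bar> \<le> K * (1 / \<rho>\<^sup>2 + 1 / \<rho> ^ 4) / x" if x: "x > 0" and \<rho>: "\<rho> > 0" for x \<rho>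
  proof -
    define c where "c = root 3 (x / 6)"
    define l where "l = of_real c * cis (pi / 6)"
    define J where "J = integral {0..pi} (\<lambda>t. exp (- (\<i> * (x * (t - sin t)))) / of_real (\<rho>\<^sup>2 + (sin t)\<^sup>2))"
    define u where "u = cis (pi * x)"
    have c: "c > 0" "c ^ 3 = x / 6" using x by (auto simp: c_def)
    have l3: "l ^ 3 = \<i> * x / 6"
      by (simp add: l_def power_mult_distrib Complex.DeMoivre c flip: of_real_power)
    have J_est: "norm (J - F (l * p) / (l * of_real (\<rho>\<^sup>2))) \<le> 110 * (1 / \<rho>\<^sup>2 + 1 / \<rho> ^ 4) / x"
      unfolding J_def p_def by (rule oscillatory_estimate[OF F l3 x \<rho>])
    have norm_l: "norm (l * of_real (\<rho>\<^sup>2)) = c * \<rho>\<^sup>2"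
      using c by (simp add: l_def norm_mult norm_power)
    have "norm (F (l * p) / (l * of_real (\<rho>\<^sup>2)) - of_real (Gamma (4/3)) / (l * of_real (\<rho>\<^sup>2)))
        \<le> 6 * \<bar>C\<bar> / p\<^sup>2 * (1 / \<rho>\<^sup>2) / x"
    proof -
      have "norm (F (l * p) - of_real (Gamma (4/3))) \<le> C / (c * p)\<^sup>2"
        using C[of "c * p"] c p by (simp add: l_def mult_ac)
      also have "\<dots> \<le> \<bar>C\<bar> / (c * p)\<^sup>2" by (intro divide_right_mono) auto
      finally have "norm (F (l * p) - of_real (Gamma (4/3))) / (c * \<rho>\<^sup>2) \<le> \<bar>C\<bar> / (c * p)\<^sup>2 / (c * \<rho>\<^sup>2)"
        using c by (intro divide_right_mono) auto
      also have "\<dots> = \<bar>C\<bar> / (c ^ 3 * p\<^sup>2 * \<rho>\<^sup>2)"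
        by (simp add: power_mult_distrib power2_eq_square power3_eq_cube mult_ac)
      also have "\<dots> = 6 * \<bar>C\<bar> / p\<^sup>2 * (1 / \<rho>\<^sup>2) / x"
        unfolding c(2) by (simp add: mult_ac)
      finally show ?thesis
        unfolding diff_divide_distrib[symmetric] norm_divide norm_l .
    qed
    with J_est have "norm (J - of_real (Gamma (4/3)) / (l * of_real (\<rho>\<^sup>2)))
        \<le> 110 * (1 / \<rho>\<^sup>2 + 1 / \<rho> ^ 4) / x + 6 * \<bar>C\<bar> / p\<^sup>2 * (1 / \<rho>\<^sup>2) / x"
      by (rule norm_diff_triangle_le)
    also have "\<dots> \<le> 110 * (1 / \<rho>\<^sup>2 + 1 / \<rho> ^ 4) / x + 6 * \<bar>C\<bar> / p\<^sup>2 * (1 / \<rho>\<^sup>2 + 1 / \<rho> ^ 4) / x"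
      using x by (intro add_left_mono divide_right_mono mult_left_mono) auto
    also have "\<dots> = K * (1 / \<rho>\<^sup>2 + 1 / \<rho> ^ 4) / x"
      by (simp add: K_def distrib_right add_divide_distrib)
    finally have J_bound: "norm (J - of_real (Gamma (4/3)) / (l * of_real (\<rho>\<^sup>2))) \<le> K * (1 / \<rho>\<^sup>2 + 1 / \<rho> ^ 4) / x" .
    \<comment> \<open>The reflection \<theta> = pi - t changes the phase to pi x - x (t - sin t);
      the factor u = cis(pi x) carries its constant part.\<close>
    have "good_H x \<rho> = Re (u * J) / pi"
    proof -
      have nz: "complex_of_real (\<rho>\<^sup>2 + (sin t)\<^sup>2) \<noteq> 0" for t
        using \<rho> by (simp only: of_real_eq_0_iff) (simp add: add_pos_nonneg less_imp_neq[symmetric])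
      have "(\<lambda>t. exp (- (\<i> * (x * (t - sin t)))) / of_real (\<rho>\<^sup>2 + (sin t)\<^sup>2)) integrable_on {0..pi}"
        by (intro integrable_continuous_real continuous_intros ballI nz)
      then have "((\<lambda>t. exp (- (\<i> * (x * (t - sin t)))) / of_real (\<rho>\<^sup>2 + (sin t)\<^sup>2)) has_integral J) {0..pi}"
        unfolding J_def by (rule integrable_integral)
      from has_integral_Re[OF has_integral_mult_right[OF this, of u]]
      have "((\<lambda>t. cos (x * (pi - t + sin (pi - t))) / (\<rho>\<^sup>2 + (sin (pi - t))\<^sup>2)) has_integral Re (u * J)) {0..pi}"
      proof (rule has_integral_eq[rotated])
        fix t
        have "u * exp (- (\<i> * (x * (t - sin t)))) = cis (x * (pi - t + sin t))"
          by (simp add: u_def cis_conv_exp algebra_simps flip: exp_add)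
        then have "u * (exp (- (\<i> * (x * (t - sin t)))) / of_real (\<rho>\<^sup>2 + (sin t)\<^sup>2))
            = cis (x * (pi - t + sin t)) / of_real (\<rho>\<^sup>2 + (sin t)\<^sup>2)"
          by simp
        then show "Re (u * (exp (- (\<i> * (x * (t - sin t)))) / of_real (\<rho>\<^sup>2 + (sin t)\<^sup>2)))
            = cos (x * (pi - t + sin (pi - t))) / (\<rho>\<^sup>2 + (sin (pi - t))\<^sup>2)"
          by (simp only: Re_divide_of_real cis.sel sin_pi_minus)
      qed
      from integral_unique[OF this] show ?thesis
        unfolding good_H_def
        using integral_flip[of pi "\<lambda>\<theta>. cos (x * (\<theta> + sin \<theta>)) / (\<rho>\<^sup>2 + (sin \<theta>)\<^sup>2)"] by simp
    qed
    \<comment> \<open>Dividing u by l contributes the phase -pi/6, which is the shift 1/6 in the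
      cosine, and Gamma(4/3) = Gamma(1/3)/3 gives the coefficient.\<close>
    moreover have "good_main x \<rho> = Re (u * (of_real (Gamma (4/3)) / (l * of_real (\<rho>\<^sup>2)))) / pi"
    proof -
      have "1/3 \<notin> (\<int>\<^sub>\<le>\<^sub>0 :: real set)" by (auto dest!: nonpos_Ints_nonpos)
      then have G: "Gamma (4/3 :: real) = 1/3 * Gamma (1/3)"
        using Gamma_plus1[of "1/3 :: real"] by simp
      have root: "(6 / x) powr (1/3) = 1 / c"
        using x by (simp add: c_def root_powr_inverse powr_divide)
      have prod: "u * (of_real (Gamma (4/3)) / (l * of_real (\<rho>\<^sup>2))) = cis (pi * (x - 1/6)) * of_real (Gamma (4/3) / (c * \<rho>\<^sup>2))"
        by (simp add: u_def l_def cis_divide[symmetric] right_diff_distrib)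
      show ?thesis
        unfolding prod unfolding good_main_def root G by (simp add: mult_ac)
    qed
    ultimately have "good_H x \<rho> - good_main x \<rho> = Re (u * (J - of_real (Gamma (4/3)) / (l * of_real (\<rho>\<^sup>2)))) / pi"
      by (simp add: right_diff_distrib diff_divide_distrib)
    also have "\<bar>\<dots>\<bar> \<le> norm (u * (J - of_real (Gamma (4/3)) / (l * of_real (\<rho>\<^sup>2)))) / 1"
      unfolding abs_divide using pi_ge_two by (intro frac_le abs_Re_le_cmod) auto
    also have "\<dots> = norm (J - of_real (Gamma (4/3)) / (l * of_real (\<rho>\<^sup>2)))"
      by (simp add: norm_mult u_def)
    also note J_bound
    finally show ?thesis .
  qed
  moreover have "K > 0" by (simp add: K_def add_pos_nonneg)
  ultimately show thesis using that by blast
qed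

section \<open>Distance from the zeros of the cosine, and the two claims\<close>

text \<open>The zeros lie at x - 2/3 in the integers. If d is the signed distance to the nearest
  integer, the cosine equals sin(pi d) in modulus, and \<epsilon> <= |d| <= 1/2 puts pi |d| in the
  range of \<open>half_le_sin\<close>.\<close>

lemma cos_away_from_zeros:
  fixes x \<epsilon> :: real
  assumes "\<epsilon> > 0" "x - 2/3 \<notin> \<int> + {-\<epsilon><..<\<epsilon>}"
  shows "\<bar>cos (pi * (x - 1/6))\<bar> \<ge> pi * \<epsilon> / 2"
proof -
  define n where "n = round (x - 2/3)"
  define d where "d = x - 2/3 - of_int n"
  have d: "\<bar>d\<bar> \<le> 1/2" using of_int_round_abs_le[of "x - 2/3"] by (simp add: d_def n_def abs_minus_commute)
  have "\<bar>d\<bar> \<ge> \<epsilon>"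
  proof (rule ccontr)
    assume "\<not> \<bar>d\<bar> \<ge> \<epsilon>"
    then have "of_int n + d \<in> \<int> + {-\<epsilon><..<\<epsilon>}" by (intro set_plus_intro) auto
    then show False using assms(2) by (simp add: d_def)
  qed
  then have "pi * \<epsilon> / 2 \<le> (pi * \<bar>d\<bar>) / 2" by simp
  also have "\<dots> \<le> sin (pi * \<bar>d\<bar>)" using d by (intro half_le_sin) auto
  also have "\<dots> \<le> \<bar>sin (pi * d)\<bar>" by (auto simp: abs_if)
  also have "\<dots> = \<bar>cos (pi * (x - 1/6))\<bar>"
  proof -
    have "pi * (x - 1/6) = pi * of_int n + (pi * d + pi / 2)"
      by (simp add: d_def field_simps)
    then have "cos (pi * (x - 1/6)) = - (cos (pi * of_int n) * sin (pi * d))"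
      by (simp add: cos_add sin_add)
    then show ?thesis by (simp add: abs_mult)
  qed
  finally show ?thesis .
qed

text \<open>The error is of order (1/\<rho>^2 + 1/\<rho>^4)/x, and which power dominates changes at
  \<rho> = 1. Divided by the size of the main term it becomes x^(-2/3) + (x \<rho>^3)^(-2/3) up to a
  constant factor: the second summand is governed by x \<rho>^3, the first by x alone, hence the two
  limits in the regime.\<close>

theorem theorem1p5:
  shows "(\<exists>C::real. \<forall>x::real. \<forall>\<rho>::real. x > 2 \<longrightarrow> \<rho> > 0 \<longrightarrow>
            (\<rho> \<le> 1 \<longrightarrow> \<bar>good_H x \<rho> - good_main x \<rho>\<bar> \<le> C / (x * \<rho> ^ 4)) \<and>
            (\<rho> \<ge> 1 \<longrightarrow> \<bar>good_H x \<rho> - good_main x \<rho>\<bar> \<le> C / (x * \<rho> ^ 2)))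
       \<and> (\<forall>(\<epsilon>::real) (F :: (real \<times> real) filter).
            \<epsilon> > 0 \<longrightarrow>
            (\<forall>\<^sub>F (x, \<rho>) in F. \<rho> > 0 \<and> x - 2/3 \<notin> \<int> + {-\<epsilon><..<\<epsilon>}) \<longrightarrow>
            filterlim (\<lambda>(x, \<rho>). x * \<rho> ^ 3) at_top F \<longrightarrow>
            filterlim (\<lambda>(x, \<rho>). x) at_top F \<longrightarrow>
            sim_regime F (\<lambda>(x, \<rho>). good_H x \<rho>) (\<lambda>(x, \<rho>). good_main x \<rho>))"
proof -
  obtain K where K: "K > 0" and bound: "\<And>x \<rho>. x > 0 \<Longrightarrow> \<rho> > 0 \<Longrightarrow>
      \<bar>good_H x \<rho> - good_main x \<rho>\<bar> \<le> K * (1 / \<rho>\<^sup>2 + 1 / \<rho> ^ 4) / x"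
    using good_H_error_bound by blast
  show ?thesis
  \<comment> \<open>The factor 2 absorbs the smaller of the two powers into the dominant
    one.\<close>
  proof (intro conjI exI[of _ "2 * K"] allI impI)
    fix x \<rho> :: real assume x: "x > 2" and \<rho>: "\<rho> > 0" "\<rho> \<le> 1"
    have "\<rho> ^ 4 \<le> \<rho>\<^sup>2" using \<rho> by (intro power_decreasing) auto
    then have "1 / \<rho>\<^sup>2 \<le> 1 / \<rho> ^ 4" using \<rho> by (intro divide_left_mono) auto
    then have "K * (1 / \<rho>\<^sup>2 + 1 / \<rho> ^ 4) / x \<le> K * (2 * (1 / \<rho> ^ 4)) / x"
      using x K by (intro divide_right_mono mult_left_mono) auto
    also have "\<dots> = 2 * K / (x * \<rho> ^ 4)" by (simp add: mult.commute)
    finally show "\<bar>good_H x \<rho> - good_main x \<rho>\<bar> \<le> 2 * K / (x * \<rho> ^ 4)"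
      using bound[of x \<rho>] x \<rho> by simp
  next
    fix x \<rho> :: real assume x: "x > 2" and \<rho>: "\<rho> > 0" "\<rho> \<ge> 1"
    have "\<rho>\<^sup>2 \<le> \<rho> ^ 4" using \<rho> by (intro power_increasing) auto
    then have "1 / \<rho> ^ 4 \<le> 1 / \<rho>\<^sup>2" using \<rho> by (intro divide_left_mono) auto
    then have "K * (1 / \<rho>\<^sup>2 + 1 / \<rho> ^ 4) / x \<le> K * (2 * (1 / \<rho>\<^sup>2)) / x"
      using x K by (intro divide_right_mono mult_left_mono) auto
    also have "\<dots> = 2 * K / (x * \<rho>\<^sup>2)" by (simp add: mult.commute)
    finally show "\<bar>good_H x \<rho> - good_main x \<rho>\<bar> \<le> 2 * K / (x * \<rho>\<^sup>2)"
      using bound[of x \<rho>] x \<rho> by simp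
  next
    fix \<epsilon> :: real and F :: "(real \<times> real) filter"
    assume \<epsilon>: "\<epsilon> > 0" and ev: "\<forall>\<^sub>F (x, \<rho>) in F. \<rho> > 0 \<and> x - 2/3 \<notin> \<int> + {-\<epsilon><..<\<epsilon>}"
      and lim3: "filterlim (\<lambda>(x, \<rho>). x * \<rho> ^ 3) at_top F"
      and lim1: "filterlim (\<lambda>(x, \<rho>). x) at_top F"
    \<comment> \<open>By \<open>cos_away_from_zeros\<close>, a x^(-1/3) / \<rho>^2 is a lower bound
      for the modulus of the main term.\<close>
    define a where "a = Gamma (1/3) / (3 * pi) * (pi * \<epsilon> / 2) * 6 powr (1/3)"
    have Gamma_pos: "Gamma (1/3 :: real) > 0" by (intro Gamma_real_pos) auto
    have a: "a > 0" using Gamma_pos \<epsilon> by (simp add: a_def)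
    show "sim_regime F (\<lambda>(x, \<rho>). good_H x \<rho>) (\<lambda>(x, \<rho>). good_main x \<rho>)"
      unfolding sim_regime_def
    proof (rule landau_o.smallI)
      fix c :: real assume c: "c > 0"
      \<comment> \<open>The threshold is half of c a / K, because the statement is applied once to x
        and once to x \<rho>^3 and the two results are added.\<close>
      have small: "\<forall>\<^sub>F p in F. f p powr (-2/3) < c * a / (2 * K)"
        if "filterlim f at_top F" for f :: "real \<times> real \<Rightarrow> real"
        using tendsto_neg_powr[OF _ that, of "-2/3"] c a K by (intro order_tendstoD(2)) auto
      show "\<forall>\<^sub>F p in F. norm ((case p of (x, \<rho>) \<Rightarrow> good_H x \<rho>) - (case p of (x, \<rho>) \<Rightarrow> good_main x \<rho>))
          \<le> c * norm \<bar>case p of (x, \<rho>) \<Rightarrow> good_main x \<rho>\<bar>"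
        using ev small[OF lim1] small[OF lim3] filterlim_at_top_dense[THEN iffD1, OF lim1, rule_format, of 0]
      proof eventually_elim
        case (elim p)
        obtain x \<rho> where p: "p = (x, \<rho>)" by (cases p)
        have x: "x > 0" and \<rho>: "\<rho> > 0" and away: "x - 2/3 \<notin> \<int> + {-\<epsilon><..<\<epsilon>}"
          and s1: "x powr (-2/3) < c * a / (2 * K)" and s3: "(x * \<rho> ^ 3) powr (-2/3) < c * a / (2 * K)"
          using elim by (auto simp: p)
        have "(x * \<rho> ^ 3) powr (-2/3) = x powr (-2/3) * (1 / \<rho>\<^sup>2)"
        proof -
          have "(\<rho> ^ 3) powr (-2/3) = \<rho> powr (3 * (-2/3))"
            using \<rho> by (simp only: powr_powr flip: powr_numeral)
          also have "\<dots> = 1 / \<rho>\<^sup>2" using \<rho> by (simp add: powr_minus_divide)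
          finally show ?thesis using x \<rho> by (simp add: powr_mult)
        qed
        then have "x powr (-2/3) * (1 + 1 / \<rho>\<^sup>2) = x powr (-2/3) + (x * \<rho> ^ 3) powr (-2/3)"
          by (simp add: distrib_left)
        also have "\<dots> \<le> c * a / (2 * K) + c * a / (2 * K)"
          using s1 s3 by (intro add_mono less_imp_le)
        also have "\<dots> = c * a / K" by simp
        finally have "x powr (-2/3) * (1 + 1 / \<rho>\<^sup>2) \<le> c * a / K" .
        then have key: "K * (x powr (-2/3) * (1 + 1 / \<rho>\<^sup>2)) \<le> c * a"
          using K by (simp add: pos_le_divide_eq mult.commute)
        have x13: "1 / x = x powr (-2/3) * x powr (-1/3)"
          using x by (simp add: powr_minus_divide flip: powr_add)
        have "\<bar>good_H x \<rho> - good_main x \<rho>\<bar> \<le> K * (1 / \<rho>\<^sup>2 + 1 / \<rho> ^ 4) / x"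
          using bound x \<rho> by blast
        also have "\<dots> = K * (1 / \<rho>\<^sup>2 + 1 / \<rho> ^ 4) * (1 / x)" by simp
        also have "\<dots> = K * (x powr (-2/3) * (1 + 1 / \<rho>\<^sup>2)) * (x powr (-1/3) / \<rho>\<^sup>2)"
          unfolding x13 using \<rho> by (simp add: field_simps eval_nat_numeral)
        also have "\<dots> \<le> c * a * (x powr (-1/3) / \<rho>\<^sup>2)"
          using key by (intro mult_right_mono) auto
        also have "\<dots> = c * (Gamma (1/3) / (3 * pi * \<rho>\<^sup>2) * (pi * \<epsilon> / 2) * (6 / x) powr (1/3))"
          using x by (simp add: a_def powr_divide powr_minus_divide)
        also have "\<dots> \<le> c * (Gamma (1/3) / (3 * pi * \<rho>\<^sup>2) * \<bar>cos (pi * (x - 1/6))\<bar> * (6 / x) powr (1/3))"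
          using cos_away_from_zeros[OF \<epsilon> away] c Gamma_pos
          by (intro mult_left_mono mult_right_mono) auto
        also have "\<dots> = c * \<bar>good_main x \<rho>\<bar>"
          using Gamma_pos by (simp add: good_main_def abs_mult)
        finally show ?case by (simp add: p)
      qed
    qed
  qed
qed

end
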